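(* Let $(\mathcal{K},\oplus,\cdot)$ be an abstract convex cone and let $m,m'>0$. Let $K,E\in\mathcal{K}$ with $K,E\neq\boldsymbol{0}$, and let $\mathcal{F}:\mathcal{K}\to\mathbb{R}_{\geqslant 0}$ be a positive $m$-homogeneous functional such that: (i) $\mathcal{F}$ is $(1/m')$-concave on $\mathcal{K}_{K;E}$; (ii) its first variation $\mathcal{G}_E$ relative to $E$ is positive and finite on $\mathcal{K}_{K;E}$. Then, for all $\lambda\in[0,1]$, $$\frac{\mathcal{F}\bigl((1-\lambda)\cdot K\oplus \lambda\cdot E\bigr)}{\mathcal{G}_E\bigl((1-\lambda)\cdot K\oplus \lambda\cdot E\bigr)}\geqslant (1-\lambda)\,\frac{\mathcal{F}(K)}{\mathcal{G}_E(K)}+\lambda\,\frac{\mathcal{F}(E)}{\mathcal{G}_E(E)}.$$ Moreover, equality holds for some $\lambda\in(0,1)$ if and only if the function $t\mapsto\mathcal{F}\bigl((1-t)\cdot K\oplus t\cdot E\bigr)^{1/m}$ is affine on $[0,\lambda]$.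
   Context: An abstract convex cone $(\mathcal{K},\oplus,\cdot)$ is a commutative semigroup $(\mathcal{K},\oplus)$ with additive identity $\boldsymbol{0}$ and a scalar multiplication $(r,K)\mapsto r\cdot K$ by real numbers $r\geqslant 0$ such that, for all $K,E\in\mathcal{K}$ and $r,s\geqslant 0$: $r\cdot(K\oplus E)=r\cdot K\oplus r\cdot E$, $(r+s)\cdot K=r\cdot K\oplus s\cdot K$, $(rs)\cdot K=r\cdot(s\cdot K)$, $1\cdot K=K$. It is also assumed that $0\cdot K=\boldsymbol{0}=r\cdot\boldsymbol{0}$, and that $K\oplus E\neq\boldsymbol{0}$ whenever $K,E\neq\boldsymbol{0}$. For $K,E\neq\boldsymbol{0}$, $\mathcal{K}_{K;E}=\{r\cdot K\oplus s\cdot E: r,s\geqslant 0,\ r+s>0\}$. A functional $\mathcal{F}:\mathcal{K}\to\mathbb{R}_{\geqslant 0}$ is positive if $\mathcal{F}(L)>0$ for all $L\neq\boldsymbol{0}$; it is $m$-homogeneous ($m>0$) if $\mathcal{F}(r\cdot L)=r^m\mathcal{F}(L)$ for all $L\in\mathcal{K}$, $r\geqslant 0$. For $\alpha>0$, it is $\alpha$-concave on $\mathcal{K}_{K;E}$ if $\mathcal{F}((1-t)\cdot L\oplus t\cdot M)^{\alpha}\geqslant(1-t)\mathcal{F}(L)^{\alpha}+t\mathcal{F}(M)^{\alpha}$ for all $L,M\in\mathcal{K}_{K;E}$ and $t\in[0,1]$. The first variation of $\mathcal{F}$ relative to $E$ is $\mathcal{G}_E(L)=\lim_{t\to0^+}\frac{\mathcal{F}(L\oplus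 t\cdot E)-\mathcal{F}(L)}{t}$, provided the limit exists (possibly $\pm\infty$).
   Formalization: The converse at the same λ fails if F has a kink at λ; proved instead: equality at λ implies affine on [0,λ], affine on [0,λ] implies equality at every s in (0,λ), hence equality for some λ iff affine on [0,λ] for some λ. *)

theory Defs
  imports "HOL-Analysis.Analysis"
begin

text \<open>The cone is an arbitrary carrier set \<open>C\<close>; the scalar multiplication is only
  constrained for nonnegative scalars.\<close>

locale abstract_convex_cone =
  fixes C :: "'a set"
    and oplus :: "'a \<Rightarrow> 'a \<Rightarrow> 'a" (infixl "\<oplus>" 65)
    and smul :: "real \<Rightarrow> 'a \<Rightarrow> 'a" (infixr "\<cdot>" 75)
    and zero :: 'a ("\<zero>")
  assumes zero_closed: "\<zero> \<in> C"
    and oplus_closed: "\<lbrakk>K \<in> C; E \<in> C\<rbrakk> \<Longrightarrow> K \<oplus> E \<in> C"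
    and smul_closed: "\<lbrakk>K \<in> C; 0 \<le> r\<rbrakk> \<Longrightarrow> r \<cdot> K \<in> C"
    and oplus_assoc: "\<lbrakk>K \<in> C; L \<in> C; E \<in> C\<rbrakk> \<Longrightarrow> (K \<oplus> L) \<oplus> E = K \<oplus> (L \<oplus> E)"
    and oplus_commute: "\<lbrakk>K \<in> C; E \<in> C\<rbrakk> \<Longrightarrow> K \<oplus> E = E \<oplus> K"
    and oplus_zero: "K \<in> C \<Longrightarrow> K \<oplus> \<zero> = K"
    and smul_oplus: "\<lbrakk>K \<in> C; E \<in> C; 0 \<le> r\<rbrakk> \<Longrightarrow> r \<cdot> (K \<oplus> E) = r \<cdot> K \<oplus> r \<cdot> E"
    and add_smul: "\<lbrakk>K \<in> C; 0 \<le> r; 0 \<le> s\<rbrakk> \<Longrightarrow> (r + s) \<cdot> K = r \<cdot> K \<oplus> s \<cdot> K"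
    and mult_smul: "\<lbrakk>K \<in> C; 0 \<le> r; 0 \<le> s\<rbrakk> \<Longrightarrow> (r * s) \<cdot> K = r \<cdot> (s \<cdot> K)"
    and one_smul: "K \<in> C \<Longrightarrow> 1 \<cdot> K = K"
    and zero_smul: "K \<in> C \<Longrightarrow> 0 \<cdot> K = \<zero>"
    and smul_zero: "0 \<le> r \<Longrightarrow> r \<cdot> \<zero> = \<zero>"
    and oplus_nonzero: "\<lbrakk>K \<in> C; E \<in> C; K \<noteq> \<zero>; E \<noteq> \<zero>\<rbrakk> \<Longrightarrow> K \<oplus> E \<noteq> \<zero>"

text \<open>The subcone $\mathcal{K}_{K;E}$.\<close>

definition subcone_gen ::
    "('a \<Rightarrow> 'a \<Rightarrow> 'a) \<Rightarrow> (real \<Rightarrow> 'a \<Rightarrow> 'a) \<Rightarrow> 'a \<Rightarrow> 'a \<Rightarrow> 'a set" where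
  "subcone_gen oplus smul K E =
     {oplus (smul r K) (smul s E) | r s. 0 \<le> r \<and> 0 \<le> s \<and> 0 < r + s}"

definition nonneg_functional :: "'a set \<Rightarrow> ('a \<Rightarrow> real) \<Rightarrow> bool" where
  "nonneg_functional C F \<longleftrightarrow> (\<forall>L\<in>C. 0 \<le> F L)"

definition positive_functional :: "'a set \<Rightarrow> 'a \<Rightarrow> ('a \<Rightarrow> real) \<Rightarrow> bool" where
  "positive_functional C zero F \<longleftrightarrow> (\<forall>L\<in>C. L \<noteq> zero \<longrightarrow> 0 < F L)"

text \<open>The case \<open>r = 0\<close> of homogeneity is consistent with \<open>powr\<close>, since \<open>0 powr m = 0\<close>.\<close>

definition homogeneous_functional ::
    "'a set \<Rightarrow> (real \<Rightarrow> 'a \<Rightarrow> 'a) \<Rightarrow> real \<Rightarrow> ('a \<Rightarrow> real) \<Rightarrow> bool" where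
  "homogeneous_functional C smul m F \<longleftrightarrow> (\<forall>L\<in>C. \<forall>r\<ge>0. F (smul r L) = r powr m * F L)"

definition power_concave_on ::
    "('a \<Rightarrow> 'a \<Rightarrow> 'a) \<Rightarrow> (real \<Rightarrow> 'a \<Rightarrow> 'a) \<Rightarrow> real \<Rightarrow> 'a set \<Rightarrow> ('a \<Rightarrow> real) \<Rightarrow> bool" where
  "power_concave_on oplus smul \<alpha> S F \<longleftrightarrow>
     (\<forall>L\<in>S. \<forall>M\<in>S. \<forall>t\<in>{0..1}.
        F (oplus (smul (1 - t) L) (smul t M)) powr \<alpha> \<ge> (1 - t) * F L powr \<alpha> + t * F M powr \<alpha>)"

text \<open>The first variation is a limit in the extended reals. As \<open>Lim\<close> is total,
  \<open>first_variation\<close> is only meaningful where \<open>has_first_variation\<close> holds.\<close>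

definition variation_quotient ::
    "('a \<Rightarrow> 'a \<Rightarrow> 'a) \<Rightarrow> (real \<Rightarrow> 'a \<Rightarrow> 'a) \<Rightarrow> ('a \<Rightarrow> real) \<Rightarrow> 'a \<Rightarrow> 'a \<Rightarrow> real \<Rightarrow> ereal" where
  "variation_quotient oplus smul F E L t = ereal ((F (oplus L (smul t E)) - F L) / t)"

definition has_first_variation ::
    "('a \<Rightarrow> 'a \<Rightarrow> 'a) \<Rightarrow> (real \<Rightarrow> 'a \<Rightarrow> 'a) \<Rightarrow> ('a \<Rightarrow> real) \<Rightarrow> 'a \<Rightarrow> 'a \<Rightarrow> bool" where
  "has_first_variation oplus smul F E L \<longleftrightarrow>
     (\<exists>g. (variation_quotient oplus smul F E L \<longlongrightarrow> g) (at_right 0))"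

definition first_variation ::
    "('a \<Rightarrow> 'a \<Rightarrow> 'a) \<Rightarrow> (real \<Rightarrow> 'a \<Rightarrow> 'a) \<Rightarrow> ('a \<Rightarrow> real) \<Rightarrow> 'a \<Rightarrow> 'a \<Rightarrow> ereal" where
  "first_variation oplus smul F E L = Lim (at_right 0) (variation_quotient oplus smul F E L)"

definition affine_function_on :: "real set \<Rightarrow> (real \<Rightarrow> real) \<Rightarrow> bool" where
  "affine_function_on S f \<longleftrightarrow> (\<exists>a b. \<forall>t\<in>S. f t = a + b * t)"

end

theory Submission
  imports Defs
begin

text \<open>Homogeneity lets one pass from level sets to a graph: by (i), \<open>F\<close> is quasi-concave, and a
  quasi-concave positive \<open>m\<close>-homogeneous functional has a concave \<open>m\<close>-th root; the exponent
  \<open>m'\<close> plays no further role. Hence \<open>\<phi> s = F (K \<oplus> s \<cdot> E) powr (1 / m)\<close> is concave on \<open>{0..}\<close>.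
  At the point \<open>(1 - \<lambda>) \<cdot> K \<oplus> \<lambda> \<cdot> E = (1 - \<lambda>) \<cdot> (K \<oplus> s \<cdot> E)\<close> with \<open>s = \<lambda> / (1 - \<lambda>)\<close>, the ratio
  of \<open>F\<close> to its first variation is \<open>(1 - \<lambda>) / m\<close> times \<open>\<phi> s / \<phi>' s\<close> (right derivatives), and
  \<open>1 / m\<close> at \<open>E\<close>, so the claim is \<open>\<phi> s / \<phi>' s \<ge> \<phi> 0 / \<phi>' 0 + s\<close>. It follows from
  \<open>\<phi> s - \<phi> 0 \<ge> s * \<phi>' s\<close> and \<open>\<phi>' s \<le> \<phi>' 0\<close>, and equality forces \<open>\<phi>' s = \<phi>' 0\<close>, that is,
  \<open>\<phi>\<close> is affine on \<open>{0..s}\<close>.\<close>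

section \<open>Right derivatives of concave functions\<close>

lemma concave_on_slopes:
  fixes f :: "real \<Rightarrow> real"
  assumes "concave_on I f" "x \<in> I" "z \<in> I" "x < y" "y < z"
  shows "(f z - f x) / (z - x) \<le> (f y - f x) / (y - x)"
    and "(f z - f y) / (z - y) \<le> (f z - f x) / (z - x)"
proof -
  have c: "convex_on I (\<lambda>x. - f x)"
    using assms(1) by (simp add: concave_on_def)
  show "(f z - f x) / (z - x) \<le> (f y - f x) / (y - x)"
    and "(f z - f y) / (z - y) \<le> (f z - f x) / (z - x)"
    using convex_on_slope_le[OF c assms(2-5)] assms(4,5) by (auto simp: field_simps)
qed

text \<open>Chord slopes from \<open>x\<close> grow as the far end moves down to \<open>x\<close>,
  so their limit dominates each of them.\<close>

lemma concave_on_slope_le_right_derivative: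
  fixes f :: "real \<Rightarrow> real"
  assumes f: "concave_on I f" "x \<in> I" "y \<in> I" "x < y"
    and d: "(f has_real_derivative d) (at_right x)"
  shows "(f y - f x) / (y - x) \<le> d"
proof (rule tendsto_lowerbound)
  show "((\<lambda>t. (f t - f x) / (t - x)) \<longlongrightarrow> d) (at_right x)"
    using d by (simp add: has_field_derivative_iff)
  show "\<forall>\<^sub>F t in at_right x. (f y - f x) / (y - x) \<le> (f t - f x) / (t - x)"
    using eventually_at_right_less eventually_at_right_real[OF \<open>x < y\<close>]
    by (rule eventually_elim2) (use concave_on_slopes(1)[OF f(1-3)] in auto)
qed simp

text \<open>Chords just right of \<open>y\<close> have at most the slope of the one from
  \<open>x\<close> to \<open>y\<close>; \<open>z\<close> leaves room in \<open>I\<close> beyond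
  \<open>y\<close>.\<close>

lemma concave_on_right_derivative_le_slope:
  fixes f :: "real \<Rightarrow> real"
  assumes f: "concave_on I f" "x \<in> I" "z \<in> I" "x < y" "y < z"
    and d: "(f has_real_derivative d) (at_right y)"
  shows "d \<le> (f y - f x) / (y - x)"
proof (rule tendsto_upperbound)
  show "((\<lambda>t. (f t - f y) / (t - y)) \<longlongrightarrow> d) (at_right y)"
    using d by (simp add: has_field_derivative_iff)
  have I: "convex I"
    using f(1) by (simp add: concave_on_iff)
  show "\<forall>\<^sub>F t in at_right y. (f t - f y) / (t - y) \<le> (f y - f x) / (y - x)"
    using eventually_at_right_real[OF \<open>y < z\<close>]
  proof eventually_elim
    case (elim t)
    then have "t \<in> I"
      using I f(2-5) mem_is_interval_1_I[of I x z t] by (auto simp: is_interval_convex_1)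
    then show ?case
      using concave_on_slopes[OF f(1,2) \<open>t \<in> I\<close> \<open>x < y\<close>] elim by force
  qed
qed simp

text \<open>The slope of the chord over \<open>{0..s}\<close> lies between \<open>ds\<close> and
  \<open>d0\<close>. The estimate loses at \<open>ds \<le> (f s - f 0) / s\<close> and at
  \<open>ds \<le> d0\<close>; equality leaves no room for either loss.\<close>

lemma concave_ratio_right_derivative:
  fixes f :: "real \<Rightarrow> real"
  assumes f: "concave_on {0..} f" and s: "0 < s"
    and d0: "(f has_real_derivative d0) (at_right 0)" "0 < d0"
    and ds: "(f has_real_derivative ds) (at_right s)" "0 < ds"
    and f0: "0 < f 0"
  shows "f 0 / d0 + s \<le> f s / ds"
    and "f s / ds = f 0 / d0 + s \<Longrightarrow> affine_function_on {0..s} f"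
proof -
  have a: "ds \<le> (f s - f 0) / s"
    using concave_on_right_derivative_le_slope[OF f _ _ s _ ds(1), of "s + 1"] s by simp
  have b: "(f x - f 0) / x \<le> d0" if "0 < x" for x
    using concave_on_slope_le_right_derivative[OF f _ _ that d0(1)] that by simp
  have le: "ds \<le> d0"
    using a b[OF s] by linarith
  have "(f 0 + ds * s) / ds \<le> f s / ds"
    using a s ds(2) by (intro divide_right_mono) (auto simp: field_simps)
  then have c: "f 0 / ds + s \<le> f s / ds"
    using ds(2) by (simp add: add_divide_distrib)
  have "f 0 / d0 \<le> f 0 / ds"
    using le f0 ds(2) by (simp add: frac_le)
  with c show "f 0 / d0 + s \<le> f s / ds"
    by linarith
  assume "f s / ds = f 0 / d0 + s"
  with c have "f 0 / ds \<le> f 0 / d0"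
    by linarith
  then have "d0 \<le> ds"
    using f0 d0(2) ds(2) by (simp add: field_simps)
  with le have eq: "ds = d0"
    by simp
  have fs: "f s = f 0 + d0 * s"
    using a b[OF s] s unfolding eq by (simp add: field_simps)
  \<comment> \<open>\<open>f\<close> is squeezed between its chord over \<open>{0..s}\<close> and
    its right tangent at 0, which now coincide.\<close>
  have "f x = f 0 + d0 * x" if x: "x \<in> {0..s}" for x
  proof (cases "x = 0 \<or> x = s")
    case False
    then have "0 < x" "x < s"
      using x by auto
    then have "d0 \<le> (f x - f 0) / x"
      using concave_on_slopes(1)[OF f _ _ \<open>0 < x\<close> \<open>x < s\<close>] fs s by simp
    with b[OF \<open>0 < x\<close>] \<open>0 < x\<close> show ?thesis
      by (simp add: field_simps)
  qed (use fs in auto)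
  then show "affine_function_on {0..s} f"
    unfolding affine_function_on_def by blast
qed

text \<open>The right derivative looks beyond \<open>x\<close>, where \<open>f\<close> must still be
  affine; at \<open>x = s\<close> it is not determined by \<open>f\<close> on the interval.\<close>

lemma affine_ratio_right_derivative:
  fixes f :: "real \<Rightarrow> real"
  assumes f: "affine_function_on {0..s} f" and x: "0 < x" "x < s"
    and d0: "(f has_real_derivative d0) (at_right 0)" "0 < d0"
    and dx: "(f has_real_derivative dx) (at_right x)"
  shows "f x / dx = f 0 / d0 + x"
proof -
  obtain a b where ab: "\<And>t. t \<in> {0..s} \<Longrightarrow> f t = a + b * t"
    using f unfolding affine_function_on_def by blast
  have b: "d = b" if "0 \<le> y" "y < s" "(f has_real_derivative d) (at_right y)" for y d
  proof (rule tendsto_unique)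
    show "((\<lambda>t. (f t - f y) / (t - y)) \<longlongrightarrow> d) (at_right y)"
      using that(3) by (simp add: has_field_derivative_iff)
    have "\<forall>\<^sub>F t in at_right y. (f t - f y) / (t - y) = b"
      using eventually_at_right_real[OF \<open>y < s\<close>]
      by eventually_elim (use that(1,2) in \<open>simp add: ab field_simps\<close>)
    then show "((\<lambda>t. (f t - f y) / (t - y)) \<longlongrightarrow> b) (at_right y)"
      by (rule tendsto_eventually)
  qed simp
  have "d0 = b" "dx = b"
    using b[of 0 d0] b[of x dx] x d0 dx by auto
  with d0(2) x show ?thesis
    by (simp add: ab field_simps)
qed

section \<open>First variations and homogeneity\<close>

text \<open>Existence makes the total \<open>Lim\<close> a genuine limit, and the two bounds exclude
  infinite values, so the convergence can be read in the reals.\<close>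

lemma tendsto_first_variation:
  assumes "has_first_variation oplus smul F E L"
    and "0 < first_variation oplus smul F E L" "first_variation oplus smul F E L < \<infinity>"
  shows "((\<lambda>t. (F (oplus L (smul t E)) - F L) / t)
           \<longlongrightarrow> real_of_ereal (first_variation oplus smul F E L)) (at_right 0)"
proof -
  obtain g where g: "(variation_quotient oplus smul F E L \<longlongrightarrow> g) (at_right 0)"
    using assms(1) unfolding has_first_variation_def by blast
  then have "first_variation oplus smul F E L = g"
    unfolding first_variation_def by (intro tendsto_Lim) simp_all
  moreover from this obtain r where "g = ereal r"
    using assms(2,3) by (cases g) auto
  ultimately show ?thesis
    using g by (simp add: variation_quotient_def [abs_def])
qed

lemma first_variation_eqI:
  assumes "((\<lambda>t. (F (oplus L (smul t E)) - F L) / t) \<longlongrightarrow> g) (at_right 0)"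
  shows "first_variation oplus smul F E L = ereal g"
  using assms unfolding first_variation_def
  by (intro tendsto_Lim) (simp_all add: variation_quotient_def [abs_def])

context abstract_convex_cone
begin

section \<open>Arithmetic of the subcone and of the ray from \<open>K\<close> in direction
  \<open>E\<close>\<close>

lemma smul_nonzero:
  assumes "L \<in> C" "L \<noteq> \<zero>" "0 < r"
  shows "r \<cdot> L \<noteq> \<zero>"
proof
  assume "r \<cdot> L = \<zero>"
  then have "(inverse r * r) \<cdot> L = \<zero>"
    using assms by (simp only: mult_smul smul_zero less_imp_le inverse_nonnegative_iff_nonnegative)
  then show False
    using assms by (simp add: one_smul)
qed

lemma subcone_gen_closed:
  assumes "K \<in> C" "E \<in> C"
  shows "subcone_gen oplus smul K E \<subseteq> C"
  using assms by (auto simp: subcone_gen_def oplus_closed smul_closed)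

text \<open>Serves to make a positive functional strictly positive on the whole subcone.\<close>

lemma subcone_gen_nonzero:
  assumes "K \<in> C" "K \<noteq> \<zero>" "E \<in> C" "E \<noteq> \<zero>" "L \<in> subcone_gen oplus smul K E"
  shows "L \<noteq> \<zero>"
proof -
  obtain r s where L: "L = r \<cdot> K \<oplus> s \<cdot> E" and rs: "0 \<le> r" "0 \<le> s" "0 < r + s"
    using assms(5) unfolding subcone_gen_def by blast
  consider "r = 0" "0 < s" | "s = 0" "0 < r" | "0 < r" "0 < s"
    using rs by argo
  then show ?thesis
  proof cases
    case 1
    then have "L = s \<cdot> E"
      using assms L by (metis oplus_commute oplus_zero smul_closed rs(2) zero_closed zero_smul)
    with 1 show ?thesis
      using assms by (simp add: smul_nonzero)
  next
    case 2
    then show ?thesis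
      using assms L by (simp add: smul_nonzero zero_smul oplus_zero smul_closed)
  next
    case 3
    then show ?thesis
      using assms L by (simp add: smul_nonzero oplus_nonzero smul_closed)
  qed
qed

lemma smul_subcone_gen:
  assumes "K \<in> C" "E \<in> C" "L \<in> subcone_gen oplus smul K E" "0 < q"
  shows "q \<cdot> L \<in> subcone_gen oplus smul K E"
proof -
  obtain r s where L: "L = r \<cdot> K \<oplus> s \<cdot> E" and rs: "0 \<le> r" "0 \<le> s" "0 < r + s"
    using assms(3) unfolding subcone_gen_def by blast
  have "q \<cdot> L = (q * r) \<cdot> K \<oplus> (q * s) \<cdot> E"
    using assms rs by (simp add: L smul_oplus smul_closed mult_smul)
  moreover have "0 < q * r + q * s"
    using assms(4) rs(3) by (metis distrib_left mult_pos_pos)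
  ultimately show ?thesis
    unfolding subcone_gen_def using assms(4) rs by force
qed

lemma segment_eq_smul_ray:
  assumes "K \<in> C" "E \<in> C" "0 \<le> t" "t < 1"
  shows "(1 - t) \<cdot> K \<oplus> t \<cdot> E = (1 - t) \<cdot> (K \<oplus> (t / (1 - t)) \<cdot> E)"
proof -
  have "(1 - t) \<cdot> (t / (1 - t)) \<cdot> E = ((1 - t) * (t / (1 - t))) \<cdot> E"
    using assms by (simp only: mult_smul divide_nonneg_pos diff_gt_0_iff_gt less_imp_le)
  then show ?thesis
    using assms by (simp add: smul_oplus smul_closed)
qed

lemma ray_mem_subcone_gen:
  assumes "K \<in> C" "0 \<le> s"
  shows "K \<oplus> s \<cdot> E \<in> subcone_gen oplus smul K E"
  unfolding subcone_gen_def using assms by (force simp: one_smul intro: exI[of _ 1])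

text \<open>Makes the first variation at a point of the ray a right derivative in the ray
  parameter.\<close>

lemma ray_add:
  assumes "K \<in> C" "E \<in> C" "0 \<le> s" "0 \<le> t"
  shows "(K \<oplus> s \<cdot> E) \<oplus> t \<cdot> E = K \<oplus> (s + t) \<cdot> E"
  using assms by (simp add: add_smul oplus_assoc smul_closed)

text \<open>Turns concavity on the subcone into concavity in the ray parameter.\<close>

lemma ray_convex_combination:
  assumes "K \<in> C" "E \<in> C" "0 \<le> a" "0 \<le> b" "0 \<le> t" "t \<le> 1"
  shows "(1 - t) \<cdot> (K \<oplus> a \<cdot> E) \<oplus> t \<cdot> (K \<oplus> b \<cdot> E) = K \<oplus> ((1 - t) * a + t * b) \<cdot> E"
proof -
  define u where "u = 1 - t"
  have u: "0 \<le> u" "u + t = 1"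
    using assms by (auto simp: u_def)
  have cl: "u \<cdot> K \<in> C" "t \<cdot> K \<in> C" "(u * a) \<cdot> E \<in> C" "(t * b) \<cdot> E \<in> C"
    using assms u by (auto simp: smul_closed)
  have "u \<cdot> (K \<oplus> a \<cdot> E) \<oplus> t \<cdot> (K \<oplus> b \<cdot> E)
      = (u \<cdot> K \<oplus> (u * a) \<cdot> E) \<oplus> (t \<cdot> K \<oplus> (t * b) \<cdot> E)"
    using assms u by (simp add: smul_oplus smul_closed mult_smul)
  also have "\<dots> = (u \<cdot> K \<oplus> t \<cdot> K) \<oplus> ((u * a) \<cdot> E \<oplus> (t * b) \<cdot> E)"
    using cl by (metis oplus_assoc oplus_commute oplus_closed)
  also have "u \<cdot> K \<oplus> t \<cdot> K = K"
    using assms u by (metis add_smul one_smul)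
  also have "(u * a) \<cdot> E \<oplus> (t * b) \<cdot> E = (u * a + t * b) \<cdot> E"
    using assms u by (simp add: add_smul)
  finally show ?thesis
    by (simp add: u_def)
qed

text \<open>Scaling \<open>L\<close> and \<open>M\<close> to the level set \<open>F = 1\<close> uses the concavity hypothesis only through the
  convexity of the superlevel set \<open>F \<ge> 1\<close>, so its exponent is irrelevant.\<close>

lemma power_concave_on_homogeneous_degree:
  assumes S: "S \<subseteq> C" "\<And>L q. L \<in> S \<Longrightarrow> 0 < q \<Longrightarrow> q \<cdot> L \<in> S"
    and pos: "\<And>L. L \<in> S \<Longrightarrow> 0 < F L"
    and nonneg: "nonneg_functional C F"
    and hom: "homogeneous_functional C smul m F"
    and m: "0 < m" and p: "0 < p"
    and concave: "power_concave_on oplus smul p S F"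
  shows "power_concave_on oplus smul (1 / m) S F"
  unfolding power_concave_on_def
proof (intro ballI)
  fix L M and t :: real
  assume L: "L \<in> S" and M: "M \<in> S" and t: "t \<in> {0..1}"
  \<comment> \<open>\<open>f\<close> is homogeneous of degree one; \<open>s\<close> is the lower
    bound to be proved for \<open>f\<close> at the convex combination.\<close>
  define f where "f L = F L powr (1 / m)" for L
  define s where "s = (1 - t) * f L + t * f M"
  have f: "0 < f L" "0 < f M"
    using pos[OF L] pos[OF M] by (auto simp: f_def)
  have LM: "L \<in> C" "M \<in> C"
    using L M S(1) by auto
  have s: "0 < s"
  proof (cases "t = 0")
    case False
    then show ?thesis
      unfolding s_def using f t by (intro add_nonneg_pos mult_pos_pos) auto
  qed (use f in \<open>simp add: s_def\<close>)
  have F_scale: "F (q \<cdot> L) = q powr m * F L" if "L \<in> C" "0 \<le> q" for L q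
    using hom that unfolding homogeneous_functional_def by blast
  have norm: "F (inverse (f L) \<cdot> L) = 1" if "L \<in> S" for L
    using that S(1) pos[OF that] m
    by (subst F_scale) (auto simp: f_def powr_powr inverse_powr powr_powr)
  \<comment> \<open>This weight makes \<open>(1 - \<tau>) / f L\<close> and
    \<open>\<tau> / f M\<close> equal to \<open>(1 - t) / s\<close> and \<open>t / s\<close>, so the
    normalized points mix to a multiple of \<open>N\<close>.\<close>
  define \<tau> where "\<tau> = t * f M / s"
  have \<tau>: "\<tau> \<in> {0..1}" "1 - \<tau> = (1 - t) * f L / s"
    using t f s by (auto simp: \<tau>_def field_simps s_def)
  define N where "N = (1 - t) \<cdot> L \<oplus> t \<cdot> M"
  have N: "N \<in> C"
    using LM t by (simp add: N_def oplus_closed smul_closed)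
  have "(1 - \<tau>) \<cdot> inverse (f L) \<cdot> L = (inverse s * (1 - t)) \<cdot> L"
  proof -
    have "(1 - \<tau>) * inverse (f L) = inverse s * (1 - t)"
      using f by (simp add: \<tau>(2) divide_inverse)
    then show ?thesis
      using mult_smul [of L "1 - \<tau>" "inverse (f L)"] LM f \<tau>(1) by simp
  qed
  moreover have "\<tau> \<cdot> inverse (f M) \<cdot> M = (inverse s * t) \<cdot> M"
  proof -
    have "\<tau> * inverse (f M) = inverse s * t"
      using f by (simp add: \<tau>_def divide_inverse)
    then show ?thesis
      using mult_smul [of M \<tau> "inverse (f M)"] LM f \<tau>(1) by simp
  qed
  ultimately have comb: "(1 - \<tau>) \<cdot> inverse (f L) \<cdot> L \<oplus> \<tau> \<cdot> inverse (f M) \<cdot> M = inverse s \<cdot> N"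
    using LM t s by (simp add: N_def smul_oplus smul_closed mult_smul)
  \<comment> \<open>Both normalized points have \<open>F = 1\<close>, so the left side is 1 whatever
    the exponent.\<close>
  have "(1 - \<tau>) * F (inverse (f L) \<cdot> L) powr p + \<tau> * F (inverse (f M) \<cdot> M) powr p
      \<le> F (inverse s \<cdot> N) powr p"
    using concave \<tau>(1) S(2)[OF L] S(2)[OF M] f
    unfolding power_concave_on_def comb [symmetric] by simp
  then have "1 powr p \<le> F (inverse s \<cdot> N) powr p"
    using norm L M by simp
  moreover have "0 \<le> F (inverse s \<cdot> N)"
    using nonneg N s by (simp add: nonneg_functional_def smul_closed)
  ultimately have "1 \<le> F (inverse s \<cdot> N)"
    using p powr_less_mono2[of p "F (inverse s \<cdot> N)" 1] by fastforce
  then have "1 \<le> inverse (s powr m) * F N"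
    using N s by (simp add: F_scale inverse_powr)
  then have "s powr m \<le> F N"
    using s by (simp add: field_simps)
  then have "(s powr m) powr (1 / m) \<le> F N powr (1 / m)"
    using m by (intro powr_mono2) auto
  then show "(1 - t) * F L powr (1 / m) + t * F M powr (1 / m)
      \<le> F ((1 - t) \<cdot> L \<oplus> t \<cdot> M) powr (1 / m)"
    using s m by (simp add: powr_powr N_def s_def f_def)
qed

text \<open>With \<open>r * t\<close> in place of \<open>t\<close>, the numerator gains
  \<open>r powr m\<close> and the denominator \<open>r\<close>: the first variation has degree
  \<open>m - 1\<close>.\<close>

lemma tendsto_variation_smul:
  assumes hom: "homogeneous_functional C smul m F"
    and L: "L \<in> C" and E: "E \<in> C" and r: "0 < r"
    and g: "((\<lambda>t. (F (L \<oplus> t \<cdot> E) - F L) / t) \<longlongrightarrow> g) (at_right 0)"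
  shows "((\<lambda>t. (F (r \<cdot> L \<oplus> t \<cdot> E) - F (r \<cdot> L)) / t) \<longlongrightarrow> r powr (m - 1) * g) (at_right 0)"
proof -
  have F_scale: "F (r \<cdot> L) = r powr m * F L" if "L \<in> C" for L
    using hom that r unfolding homogeneous_functional_def by simp
  have "(F (r \<cdot> L \<oplus> (r * t) \<cdot> E) - F (r \<cdot> L)) / (r * t)
      = r powr (m - 1) * ((F (L \<oplus> t \<cdot> E) - F L) / t)" if "0 < t" for t
  proof -
    have "r \<cdot> L \<oplus> (r * t) \<cdot> E = r \<cdot> (L \<oplus> t \<cdot> E)"
      using L E r that by (simp add: smul_oplus mult_smul smul_closed)
    then show ?thesis
      using L E r that by (simp add: F_scale oplus_closed smul_closed powr_diff field_simps)
  qed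
  then have "\<forall>\<^sub>F t in at_right 0. r powr (m - 1) * ((F (L \<oplus> t \<cdot> E) - F L) / t)
      = (F (r \<cdot> L \<oplus> (r * t) \<cdot> E) - F (r \<cdot> L)) / (r * t)"
    using eventually_at_right_less[of "0::real"] by (auto elim: eventually_mono)
  then have "((\<lambda>t. (F (r \<cdot> L \<oplus> (r * t) \<cdot> E) - F (r \<cdot> L)) / (r * t))
      \<longlongrightarrow> r powr (m - 1) * g) (at_right 0)"
    using tendsto_mult_left[OF g] by (rule Lim_transform_eventually[rotated])
  \<comment> \<open>Scaling by \<open>r > 0\<close> carries the filter \<open>at_right 0\<close> to
    itself, which absorbs the factor in the argument.\<close>
  then have "((\<lambda>t. (F (r \<cdot> L \<oplus> t \<cdot> E) - F (r \<cdot> L)) / t)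
      \<longlongrightarrow> r powr (m - 1) * g) (filtermap (times r) (at_right 0))"
    unfolding filterlim_filtermap .
  then show ?thesis
    using filtermap_times_pos_at_right[OF r, of 0] by simp
qed

text \<open>Euler's identity in the direction of \<open>E\<close> itself:
  \<open>E \<oplus> t \<cdot> E\<close> is \<open>(1 + t) \<cdot> E\<close>, and
  \<open>(1 + t) powr m\<close> has derivative \<open>m\<close> at 0.\<close>

lemma tendsto_variation_self:
  assumes hom: "homogeneous_functional C smul m F" and E: "E \<in> C"
  shows "((\<lambda>t. (F (E \<oplus> t \<cdot> E) - F E) / t) \<longlongrightarrow> m * F E) (at_right 0)"
proof -
  have "((\<lambda>t. (1 + t) powr m) has_real_derivative m) (at 0)"
    by (auto intro!: derivative_eq_intros)
  then have "((\<lambda>t::real. ((1 + t) powr m - 1) / t) \<longlongrightarrow> m) (at_right 0)"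
    by (auto simp: has_field_derivative_iff intro: tendsto_mono[OF at_le])
  then have "((\<lambda>t::real. ((1 + t) powr m - 1) / t * F E) \<longlongrightarrow> m * F E) (at_right 0)"
    by (rule tendsto_mult_right)
  moreover have "\<forall>\<^sub>F t::real in at_right 0.
      ((1 + t) powr m - 1) / t * F E = (F (E \<oplus> t \<cdot> E) - F E) / t"
    using eventually_at_right_less[of "0::real"]
  proof eventually_elim
    case (elim t)
    then have "E \<oplus> t \<cdot> E = (1 + t) \<cdot> E"
      using E by (simp add: add_smul one_smul)
    moreover have "F ((1 + t) \<cdot> E) = (1 + t) powr m * F E"
      using hom E elim unfolding homogeneous_functional_def by simp
    ultimately show ?case
      by (simp add: left_diff_distrib)
  qed
  ultimately show ?thesis
    by (rule Lim_transform_eventually)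
qed

end

section \<open>Affine functions under the projective change of parameter\<close>

text \<open>The factor \<open>1 - t\<close> clears the denominator of \<open>t / (1 - t)\<close>, so
  affine functions of one parameter correspond to affine functions of the other.\<close>

lemma affine_function_on_projective:
  assumes l: "0 \<le> l" "l < 1"
    and f: "\<And>t. t \<in> {0..l} \<Longrightarrow> f t = (1 - t) * \<phi> (t / (1 - t))"
  shows "affine_function_on {0..l} f \<longleftrightarrow> affine_function_on {0..l / (1 - l)} \<phi>"
proof
  assume "affine_function_on {0..l} f"
  then obtain a b where ab: "\<And>t. t \<in> {0..l} \<Longrightarrow> f t = a + b * t"
    unfolding affine_function_on_def by blast
  have "\<phi> s = a + (a + b) * s" if s: "s \<in> {0..l / (1 - l)}" for s
  proof -
    \<comment> \<open>The inverse change of parameter; multiplying \<open>a + b * t\<close> by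
      \<open>1 + s\<close> gives the coefficients claimed for \<phi>.\<close>
    define t where "t = s / (1 + s)"
    have t: "1 - t = 1 / (1 + s)" "t / (1 - t) = s" "t \<in> {0..l}"
      using s l by (auto simp: t_def field_simps)
    have "a + b * t = \<phi> s / (1 + s)"
      using f[OF t(3)] ab[OF t(3)] t(1,2) by simp
    then show ?thesis
      using s by (simp add: t_def field_simps)
  qed
  then show "affine_function_on {0..l / (1 - l)} \<phi>"
    unfolding affine_function_on_def by blast
next
  assume "affine_function_on {0..l / (1 - l)} \<phi>"
  then obtain a b where ab: "\<And>s. s \<in> {0..l / (1 - l)} \<Longrightarrow> \<phi> s = a + b * s"
    unfolding affine_function_on_def by blast
  have "f t = a + (b - a) * t" if t: "t \<in> {0..l}" for t
  proof -
    define u where "u = t / (1 - t)"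
    have u: "(1 - t) * u = t"
      using t l by (simp add: u_def)
    have "u \<in> {0..l / (1 - l)}"
      using t l by (auto simp: u_def intro!: frac_le)
    then have "f t = (1 - t) * (a + b * u)"
      using f[OF t] ab by (simp add: u_def)
    also have "\<dots> = (1 - t) * a + b * ((1 - t) * u)"
      by (simp add: algebra_simps)
    finally show ?thesis
      unfolding u by (simp add: algebra_simps)
  qed
  then show "affine_function_on {0..l} f"
    unfolding affine_function_on_def by blast
qed

text \<open>Affinity on \<open>{0..l}\<close> yields equality strictly below \<open>l\<close> only:
  the first variation is one-sided, and the root may have a kink at \<open>l\<close>. In the
  nonnegative quadrant with \<open>K = (1, 0)\<close> and \<open>E = (0, 1)\<close>,
  \<open>min (x + 2 * y) (2 * x + y)\<close> shows this at \<open>l = 1 / 2\<close>. Hence the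
  equality clause combines an equivalence of existence statements with a pointwise implication in
  each direction.\<close>

theorem theorem1p1:
  fixes C :: "'a set"
    and oplus :: "'a \<Rightarrow> 'a \<Rightarrow> 'a" (infixl "\<oplus>" 65)
    and smul :: "real \<Rightarrow> 'a \<Rightarrow> 'a" (infixr "\<cdot>" 75)
    and zero :: 'a ("\<zero>")
    and K E :: 'a
    and F :: "'a \<Rightarrow> real"
    and m m' :: real
  assumes cone: "abstract_convex_cone C oplus smul zero"
    and m: "0 < m" and m': "0 < m'"
    and K: "K \<in> C" "K \<noteq> \<zero>" and E: "E \<in> C" "E \<noteq> \<zero>"
    and nonneg: "nonneg_functional C F"
    and pos: "positive_functional C zero F"
    and hom: "homogeneous_functional C smul m F"
    and concave: "power_concave_on oplus smul (1 / m') (subcone_gen oplus smul K E) F"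
    and variation: "\<And>L. L \<in> subcone_gen oplus smul K E \<Longrightarrow>
          has_first_variation oplus smul F E L \<and>
          0 < first_variation oplus smul F E L \<and> first_variation oplus smul F E L < \<infinity>"
  shows "let G = (\<lambda>L. real_of_ereal (first_variation oplus smul F E L));
             c = (\<lambda>t::real. (1 - t) \<cdot> K \<oplus> t \<cdot> E);
             rhs = (\<lambda>l::real. (1 - l) * (F K / G K) + l * (F E / G E));
             equality_at = (\<lambda>l. F (c l) / G (c l) = rhs l);
             affine_to = (\<lambda>l. affine_function_on {0..l} (\<lambda>t. F (c t) powr (1 / m)))
         in (\<forall>l\<in>{0..1}. F (c l) / G (c l) \<ge> rhs l)
          \<and> ((\<exists>l\<in>{0<..<1}. equality_at l) \<longleftrightarrow> (\<exists>l\<in>{0<..<1}. affine_to l))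
          \<and> (\<forall>l\<in>{0<..<1}. equality_at l \<longrightarrow> affine_to l)
          \<and> (\<forall>l\<in>{0<..<1}. affine_to l \<longrightarrow> (\<forall>s\<in>{0<..<l}. equality_at s))"
proof -
  interpret abstract_convex_cone C oplus smul zero
    by (fact cone)
  define S where "S = subcone_gen oplus smul K E"
  define G where "G L = real_of_ereal (first_variation oplus smul F E L)" for L
  define h where "h s = F (K \<oplus> s \<cdot> E)" for s
  define h' where "h' s = G (K \<oplus> s \<cdot> E)" for s
  define \<phi> where "\<phi> s = h s powr (1 / m)" for s
  define \<phi>' where "\<phi>' s = 1 / m * h s powr (1 / m - 1) * h' s" for s
  define c where "c t = (1 - t) \<cdot> K \<oplus> t \<cdot> E" for t :: real
  define rhs where "rhs l = (1 - l) * (F K / G K) + l * (F E / G E)" for l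

  \<comment> \<open>The functional and its first variation on the subcone\<close>
  have ray_C: "K \<oplus> s \<cdot> E \<in> C" if "0 \<le> s" for s
    using K E that by (simp add: oplus_closed smul_closed)
  have ray_S: "K \<oplus> s \<cdot> E \<in> S" if "0 \<le> s" for s
    using ray_mem_subcone_gen K that by (simp add: S_def)
  have F_pos: "0 < F L" if "L \<in> S" for L
    using pos subcone_gen_nonzero[OF K E] subcone_gen_closed[OF K(1) E(1)] that
    unfolding positive_functional_def S_def by blast
  have F_scale: "F (q \<cdot> L) = q powr m * F L" if "L \<in> C" "0 \<le> q" for L q
    using hom that unfolding homogeneous_functional_def by blast
  have G: "((\<lambda>t. (F (L \<oplus> t \<cdot> E) - F L) / t) \<longlongrightarrow> G L) (at_right 0)" "0 < G L" if "L \<in> S" for L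
    using tendsto_first_variation variation[of L] that
    by (auto simp: G_def S_def zero_less_real_of_ereal)
  have G_eqI: "G L = g" if "((\<lambda>t. (F (L \<oplus> t \<cdot> E) - F L) / t) \<longlongrightarrow> g) (at_right 0)" for L g
    using first_variation_eqI[of F oplus L smul E g] that by (simp add: G_def)
  have h_pos: "0 < h s" "0 < h' s" if "0 \<le> s" for s
    using that ray_S F_pos G(2) by (auto simp: h_def h'_def)
  have \<phi>_pos: "0 < \<phi> s" "0 < \<phi>' s" if "0 \<le> s" for s
    using h_pos[OF that] m by (auto simp: \<phi>_def \<phi>'_def)

  \<comment> \<open>Concavity and right derivative along the ray\<close>
  have "power_concave_on oplus smul (1 / m) S F"
    by (rule power_concave_on_homogeneous_degree[where p = "1 / m'"])
       (use subcone_gen_closed smul_subcone_gen F_pos nonneg hom m m' concave K E in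
          \<open>auto simp: S_def\<close>)
  then have \<phi>: "concave_on {0..} \<phi>"
    unfolding power_concave_on_def
    by (intro concave_on_linorderI)
       (auto simp: \<phi>_def h_def ray_S K E ray_convex_combination [symmetric])
  have h_deriv: "(h has_real_derivative h' s) (at_right s)" if "0 \<le> s" for s
  proof -
    \<comment> \<open>The variation quotient at the ray point is the difference quotient of
      \<open>h\<close> at \<open>s\<close>, with the right limit shifted from \<open>s\<close> to
      0.\<close>
    have "\<forall>\<^sub>F t in at_right 0. (F (K \<oplus> s \<cdot> E \<oplus> t \<cdot> E) - F (K \<oplus> s \<cdot> E)) / t
        = (h (t + s) - h s) / (t + s - s)"
      using eventually_at_right_less[of "0::real"]
      by eventually_elim (use K E that in \<open>simp add: ray_add h_def add.commute\<close>)
    with G(1)[OF ray_S[OF that]]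
    have "((\<lambda>t. (h (t + s) - h s) / (t + s - s)) \<longlongrightarrow> h' s) (at_right 0)"
      unfolding h'_def by (rule Lim_transform_eventually)
    then show ?thesis
      unfolding has_field_derivative_iff filterlim_at_right_to_0[of _ _ s] .
  qed
  have \<phi>_deriv: "(\<phi> has_real_derivative \<phi>' s) (at_right s)" if "0 \<le> s" for s
    unfolding \<phi>_def \<phi>'_def
    using DERIV_chain2[OF has_real_derivative_powr h_deriv] h_pos(1) that by blast
  \<comment> \<open>Taking the \<open>m\<close>-th root divides the logarithmic derivative by
    \<open>m\<close>.\<close>
  have \<phi>_ratio: "h s / h' s = \<phi> s / \<phi>' s / m" if "0 \<le> s" for s
    using h_pos[OF that] m by (simp add: \<phi>_def \<phi>'_def powr_diff)

  \<comment> \<open>Transfer of the ratios and of the root from the segment to the ray\<close>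
  have h0: "F K / G K = h 0 / h' 0"
    using K E by (simp add: h_def h'_def zero_smul oplus_zero)
  have FE: "0 < F E"
    using pos E by (simp add: positive_functional_def)
  then have ratio_E: "F E / G E = 1 / m"
    using G_eqI[OF tendsto_variation_self[OF hom E(1)]] by simp
  have c_ray: "c t = (1 - t) \<cdot> (K \<oplus> (t / (1 - t)) \<cdot> E)" if "0 \<le> t" "t < 1" for t
    using segment_eq_smul_ray that K E by (simp add: c_def)
  \<comment> \<open>\<open>F\<close> scales with exponent \<open>m\<close> and \<open>G\<close> with
    \<open>m - 1\<close>, so their ratio scales linearly.\<close>
  have ratio_c: "F (c l) / G (c l) = (1 - l) * (h (l / (1 - l)) / h' (l / (1 - l)))"
    if l: "0 \<le> l" "l < 1" for l
  proof -
    have s: "0 \<le> l / (1 - l)"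
      using l by simp
    have "G (c l) = (1 - l) powr (m - 1) * h' (l / (1 - l))"
      unfolding c_ray[OF l] h'_def
      by (rule G_eqI, rule tendsto_variation_smul[OF hom]) (use l s ray_C ray_S G E in auto)
    moreover have "F (c l) = (1 - l) powr m * h (l / (1 - l))"
      using l s by (simp add: c_ray F_scale ray_C h_def)
    ultimately show ?thesis
      using l by (simp add: powr_diff)
  qed
  have diff: "F (c l) / G (c l) - rhs l
      = (1 - l) / m * (\<phi> (l / (1 - l)) / \<phi>' (l / (1 - l)) - (\<phi> 0 / \<phi>' 0 + l / (1 - l)))"
    if l: "0 \<le> l" "l < 1" for l
  proof -
    have "0 \<le> l / (1 - l)"
      using l by simp
    then have "F (c l) / G (c l) - rhs l
        = (1 - l) * (\<phi> (l / (1 - l)) / \<phi>' (l / (1 - l)) / m) - ((1 - l) * (\<phi> 0 / \<phi>' 0 / m) + l * (1 / m))"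
      unfolding ratio_c[OF l] rhs_def ratio_E h0 by (simp only: \<phi>_ratio order_refl)
    \<comment> \<open>The contribution of \<open>E\<close> becomes exactly the shift by the ray
      parameter \<open>l / (1 - l)\<close>.\<close>
    also have "l * (1 / m) = (1 - l) / m * (l / (1 - l))"
      using l by simp
    also have "(1 - l) * (x / m) - ((1 - l) * (y / m) + (1 - l) / m * z)
        = (1 - l) / m * (x - (y + z))" for x y z
      by (simp add: algebra_simps add_divide_distrib diff_divide_distrib)
    finally show ?thesis .
  qed
  have eq_iff: "F (c l) / G (c l) = rhs l
      \<longleftrightarrow> \<phi> (l / (1 - l)) / \<phi>' (l / (1 - l)) = \<phi> 0 / \<phi>' 0 + l / (1 - l)"
    if l: "l \<in> {0<..<1}" for l
    using diff[of l] l m by auto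
  \<comment> \<open>The \<open>m\<close>-th root has degree one, which gives the form required for
    the projective change of parameter.\<close>
  have root_c: "F (c t) powr (1 / m) = (1 - t) * \<phi> (t / (1 - t))" if "0 \<le> t" "t < 1" for t
  proof -
    have "0 \<le> t / (1 - t)"
      using that by simp
    then show ?thesis
      using that m h_pos(1)
      by (simp add: c_ray F_scale ray_C h_def [symmetric] \<phi>_def powr_mult powr_powr less_imp_le)
  qed
  have affine_iff: "affine_function_on {0..l} (\<lambda>t. F (c t) powr (1 / m))
      \<longleftrightarrow> affine_function_on {0..l / (1 - l)} \<phi>" if "l \<in> {0<..<1}" for l
    using that root_c by (intro affine_function_on_projective) auto

  \<comment> \<open>The inequality\<close>
  have ineq: "rhs l \<le> F (c l) / G (c l)" if l: "l \<in> {0..1}" for l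
  proof -
    consider "l = 0" | "l = 1" | "0 < l" "l < 1"
      using l by force
    then show ?thesis
    proof cases
      case 1
      then show ?thesis
        using diff[of 0] by simp
    next
      case 2
      \<comment> \<open>No ray parameter corresponds to \<open>l = 1\<close>, so this end is checked
        directly.\<close>
      have "c 1 = E"
        using K E by (metis c_def diff_self one_smul oplus_commute oplus_zero zero_closed zero_smul)
      with 2 show ?thesis
        by (simp add: rhs_def)
    next
      case 3
      then have "0 \<le> \<phi> (l / (1 - l)) / \<phi>' (l / (1 - l)) - (\<phi> 0 / \<phi>' 0 + l / (1 - l))"
        using concave_ratio_right_derivative(1)[OF \<phi> _ \<phi>_deriv _ \<phi>_deriv] \<phi>_pos by simp
      then show ?thesis
        using diff[of l] 3 m by (smt (verit) divide_nonneg_pos mult_nonneg_nonneg)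
    qed
  qed

  \<comment> \<open>The equality case\<close>
  have to_affine: "affine_function_on {0..l} (\<lambda>t. F (c t) powr (1 / m))"
    if "l \<in> {0<..<1}" "F (c l) / G (c l) = rhs l" for l
    using concave_ratio_right_derivative(2)[OF \<phi> _ \<phi>_deriv _ \<phi>_deriv] \<phi>_pos that eq_iff[OF that(1)]
    by (simp add: affine_iff[OF that(1)])
  have to_equality: "F (c s) / G (c s) = rhs s"
    if l: "l \<in> {0<..<1}" "affine_function_on {0..l} (\<lambda>t. F (c t) powr (1 / m))" and s: "s \<in> {0<..<l}" for l s
  proof -
    \<comment> \<open>Strictness must survive the change of parameter, since affinity does not
      control the right derivative at the right end.\<close>
    have "s / (1 - s) < l / (1 - l)"
      using l(1) s by (intro frac_less) auto
    then show ?thesis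
      using affine_ratio_right_derivative[OF l(2)[unfolded affine_iff[OF l(1)]] _ _ \<phi>_deriv _ \<phi>_deriv]
        \<phi>_pos l(1) s eq_iff[of s] by simp
  qed
  have "(\<exists>l\<in>{0<..<1}. F (c l) / G (c l) = rhs l)
      \<longleftrightarrow> (\<exists>l\<in>{0<..<1}. affine_function_on {0..l} (\<lambda>t. F (c t) powr (1 / m)))"
  proof
    assume "\<exists>l\<in>{0<..<1}. affine_function_on {0..l} (\<lambda>t. F (c t) powr (1 / m))"
    then obtain l where l: "l \<in> {0<..<1}" "affine_function_on {0..l} (\<lambda>t. F (c t) powr (1 / m))"
      by blast
    then show "\<exists>l\<in>{0<..<1}. F (c l) / G (c l) = rhs l"
      \<comment> \<open>Any point strictly between 0 and \<open>l\<close> would serve as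
        witness.\<close>
      using to_equality[OF l, of "l / 2"] by (intro bexI[of _ "l / 2"]) auto
  qed (use to_affine in blast)
  then show ?thesis
    unfolding Let_def G_def [symmetric] c_def [symmetric] rhs_def [symmetric]
    using ineq to_affine to_equality by blast
qed

end
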